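(* Let $n, d \ge 1$ be integers and let $v_1, \dots, v_n$ be unit vectors in $\mathbb{R}^d$. Suppose $u \in \mathbb{R}^d$ is a unit vector that maximizes $\prod_{i=1}^n \left|\langle v_i, u \rangle\right|$ among all unit vectors, i.e. $\prod_{i=1}^n \left|\langle v_i, x \rangle\right| \le \prod_{i=1}^n \left|\langle v_i, u \rangle\right|$ for every unit vector $x \in \mathbb{R}^d$. Then $\left|\langle v_i, u \rangle\right| \ge \sin\frac{\pi}{2n}$ for all $i \in \{1, \dots, n\}$.
   Context: $\langle \cdot, \cdot \rangle$ denotes the standard Euclidean inner product on $\mathbb{R}^d$, and a unit vector is a vector of Euclidean norm $1$. The vectors $v_1, \dots, v_n$ are not assumed to be distinct. *)

theory Defs
  imports "HOL-Analysis.Analysis"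
begin

end

theory Submission
  imports Defs "HOL-Computational_Algebra.Polynomial"
begin

text \<open>Let \<open>w\<close> be a unit vector orthogonal to \<open>u\<close> in the plane of \<open>u\<close> and \<open>v\<^sub>m\<close>. On the circle
  \<open>cos t u + sin t w\<close> the product of the \<open>\<langle>v\<^sub>i, \<cdot>\<rangle>\<close> is a trigonometric form of degree \<open>n\<close> whose modulus is
  maximal at \<open>t = 0\<close>. By a theorem of M. Riesz its distance to the nearest zero is at least that of
  \<open>cos (n t)\<close>, namely \<open>\<pi> / (2 n)\<close>, while the factor \<open>v\<^sub>m\<close> vanishes at distance
  \<open>arcsin \<bar>\<langle>v\<^sub>m, u\<rangle>\<bar>\<close>.\<close>

section \<open>Divided differences and polynomials in the cotangent\<close>

text \<open>Lagrange interpolation at the nodes reproduces \<open>r\<close>, and the sum is the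
  coefficient of index \<open>card I - 1\<close> of the interpolant. Bounding coefficients instead
  of \<open>degree r\<close> also covers a single node, where \<open>r\<close> has to be 0.\<close>

lemma divided_difference_eq_0:
  fixes s :: "'i \<Rightarrow> 'a::field" and r :: "'a poly"
  assumes fin: "finite I" and inj: "inj_on s I"
    and r: "\<And>k. card I \<le> Suc k \<Longrightarrow> coeff r k = 0"
  shows "(\<Sum>i\<in>I. poly r (s i) / (\<Prod>j\<in>I-{i}. s i - s j)) = 0"
proof (cases "I = {}")
  case False
  define w where "w i = (\<Prod>j\<in>I-{i}. s i - s j)" for i
  define L where "L i = (\<Prod>j\<in>I-{i}. [:- s j, 1:])" for i
  define F where "F = (\<Sum>i\<in>I. smult (poly r (s i) / w i) (L i))"
  have pos: "card I > 0" using False fin by (simp add: card_gt_0_iff)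
  have w0: "w i \<noteq> 0" if "i \<in> I" for i
    using that fin inj by (auto simp: w_def prod_zero_iff inj_on_def)
  have degL: "degree (L i) = card I - 1" if "i \<in> I" for i
    using that fin by (simp add: L_def degree_prod_eq_sum_degree)
  have monic: "coeff (L i) (card I - 1) = 1" if "i \<in> I" for i
    using degL[OF that] lead_coeff_prod[of "\<lambda>j. [:- s j, 1:]" "I-{i}"]
    by (simp add: L_def)
  have Lval: "poly (L i) (s k) = (if k = i then w i else 0)" if "i \<in> I" "k \<in> I" for i k
    using that fin by (auto simp: L_def w_def poly_prod prod_zero_iff)
  have Fval: "poly F (s k) = poly r (s k)" if "k \<in> I" for k
  proof -
    have "poly F (s k) = (\<Sum>i\<in>I. if k = i then poly r (s i) else 0)"
      unfolding F_def poly_sum using that by (intro sum.cong) (auto simp: Lval w0)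
    then show ?thesis using fin that by simp
  qed
  have "F = r"
  proof (rule poly_eqI_degree[of "s ` I"])
    show "poly F x = poly r x" if "x \<in> s ` I" for x using that Fval by auto
    have "degree F \<le> card I - 1"
      unfolding F_def using fin by (intro degree_sum_le) (auto simp: degL)
    then show "degree F < card (s ` I)" using pos inj by (simp add: card_image)
    have "degree r \<le> card I - 1" by (intro degree_le) (auto intro!: r)
    then show "degree r < card (s ` I)" using pos inj by (simp add: card_image)
  qed
  then have "0 = coeff F (card I - 1)" using r pos by simp
  also have "\<dots> = (\<Sum>i\<in>I. poly r (s i) / w i)"
    unfolding F_def coeff_sum by (intro sum.cong) (auto simp: monic[unfolded One_nat_def])
  finally show ?thesis by (simp add: w_def)
qed simp

text \<open>The two polynomials are the real and imaginary parts of \<open>(X + \<i>)\<^sup>n\<close>.\<close>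
lemma ex_cot_multiple_angle_polys:
  assumes "n \<ge> 1"
  shows "\<exists>A B :: real poly.
    (\<forall>t. sin t \<noteq> 0 \<longrightarrow> sin t ^ n * poly A (cot t) = cos (real n * t) \<and>
                     sin t ^ n * poly B (cot t) = sin (real n * t)) \<and>
    coeff A n = 1 \<and> coeff A (n - 1) = 0 \<and> (\<forall>k>n. coeff A k = 0) \<and> (\<forall>k\<ge>n. coeff B k = 0)"
  using assms
proof (induction n rule: dec_induct)
  case base
  show ?case
    by (rule exI[of _ "[:0, 1:]"], rule exI[of _ 1])
      (auto simp: cot_def coeff_pCons split: nat.splits)
next
  case (step n)
  then obtain A B :: "real poly" where
    AB: "\<And>t. sin t \<noteq> 0 \<Longrightarrow> sin t ^ n * poly A (cot t) = cos (real n * t)"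
        "\<And>t. sin t \<noteq> 0 \<Longrightarrow> sin t ^ n * poly B (cot t) = sin (real n * t)"
    and c: "coeff A n = 1" "coeff A (n - 1) = 0" "\<forall>k>n. coeff A k = 0" "\<forall>k\<ge>n. coeff B k = 0"
    by blast
  \<comment> \<open>The new pair comes from \<open>(X + \<i>) * (A + \<i> * B)\<close>, split into
    real and imaginary part.\<close>
  have val: "sin t ^ Suc n * poly (pCons 0 A - B) (cot t) = cos (real (Suc n) * t)"
    "sin t ^ Suc n * poly (A + pCons 0 B) (cot t) = sin (real (Suc n) * t)" if "sin t \<noteq> 0" for t
  proof -
    have sc: "sin t * cot t = cos t" using that by (simp add: cot_def)
    have "sin t ^ Suc n * poly (pCons 0 A - B) (cot t)
        = (sin t * cot t) * (sin t ^ n * poly A (cot t)) - sin t * (sin t ^ n * poly B (cot t))"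
      by (simp add: algebra_simps)
    also have "\<dots> = cos (real (Suc n) * t)"
      unfolding sc AB[OF that] by (simp add: cos_add algebra_simps)
    finally show "sin t ^ Suc n * poly (pCons 0 A - B) (cot t) = cos (real (Suc n) * t)" .
    have "sin t ^ Suc n * poly (A + pCons 0 B) (cot t)
        = sin t * (sin t ^ n * poly A (cot t)) + (sin t * cot t) * (sin t ^ n * poly B (cot t))"
      by (simp add: algebra_simps)
    also have "\<dots> = sin (real (Suc n) * t)"
      unfolding sc AB[OF that] by (simp add: sin_add algebra_simps)
    finally show "sin t ^ Suc n * poly (A + pCons 0 B) (cot t) = sin (real (Suc n) * t)" .
  qed
  show ?case
    by (rule exI[of _ "pCons 0 A - B"], rule exI[of _ "A + pCons 0 B"])
      (use val c step.hyps in \<open>auto simp: coeff_pCons split: nat.splits\<close>)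
qed

text \<open>Supplies the two top coefficients (the second by Vieta) that must cancel against those
  of the multiple-angle polynomial.\<close>

lemma coeff_prod_monic_linear:
  fixes c :: "'i \<Rightarrow> 'a::comm_ring_1"
  assumes "finite I"
  shows "coeff (\<Prod>i\<in>I. [:c i, 1:]) (card I) = 1"
    and "\<And>k. k > card I \<Longrightarrow> coeff (\<Prod>i\<in>I. [:c i, 1:]) k = 0"
    and "I \<noteq> {} \<Longrightarrow> coeff (\<Prod>i\<in>I. [:c i, 1:]) (card I - 1) = (\<Sum>i\<in>I. c i)"
proof -
  \<comment> \<open>One joint induction: a new factor adds \<open>c x\<close> times the old leading
    coefficient to the second one.\<close>
  have "coeff (\<Prod>i\<in>I. [:c i, 1:]) (card I) = 1 \<and>
    (\<forall>k > card I. coeff (\<Prod>i\<in>I. [:c i, 1:]) k = 0) \<and>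
    (I \<noteq> {} \<longrightarrow> coeff (\<Prod>i\<in>I. [:c i, 1:]) (card I - 1) = (\<Sum>i\<in>I. c i))"
    using assms
  proof (induction rule: finite_induct)
    case (insert x F)
    have [simp]: "coeff ([:c x, 1:] * p) k = c x * coeff p k + (if k = 0 then 0 else coeff p (k - 1))"
      for p k by (simp add: coeff_pCons')
    show ?case
    \<comment> \<open>For empty \<open>F\<close> the index \<open>card F - 1\<close> is truncated to
      0 and the third claim of the induction hypothesis is void.\<close>
    proof (cases "F = {}")
      case False
      then have "card F > 0" using insert by (simp add: card_gt_0_iff)
      then show ?thesis using insert False
        by (simp del: mult_pCons_left)
    qed (use insert in \<open>auto simp: coeff_pCons'\<close>)
  qed auto
  then show "coeff (\<Prod>i\<in>I. [:c i, 1:]) (card I) = 1"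
    and "\<And>k. k > card I \<Longrightarrow> coeff (\<Prod>i\<in>I. [:c i, 1:]) k = 0"
    and "I \<noteq> {} \<Longrightarrow> coeff (\<Prod>i\<in>I. [:c i, 1:]) (card I - 1) = (\<Sum>i\<in>I. c i)"
    by blast+
qed

lemma cot_strict_antimono:
  assumes "0 < x" "x < y" "y < pi"
  shows "cot y < cot x"
proof -
  have "sin x > 0" "sin y > 0" "sin (y - x) > 0" using assms by (auto intro!: sin_gt_zero)
  moreover have "sin (y - x) = sin y * cos x - cos y * sin x" by (simp add: sin_diff)
  ultimately show ?thesis by (simp add: cot_def field_simps)
qed

text \<open>Exactly the \<open>k\<close> factors with \<open>j < k\<close> are negative.\<close>

lemma sign_prod_differences_decreasing:
  fixes s :: "nat \<Rightarrow> 'a::linordered_idom"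
  assumes dec: "\<And>i j. i < j \<Longrightarrow> j < n \<Longrightarrow> s j < s i" and k: "k < n"
  shows "(-1) ^ k * (\<Prod>j\<in>{..<n}-{k}. s k - s j) > 0"
proof -
  have split: "{..<n} - {k} = {..<k} \<union> {k<..<n}" using k by auto
  have "(-1) ^ k * (\<Prod>j\<in>{..<n}-{k}. s k - s j)
      = (\<Prod>j<k. - (s k - s j)) * (\<Prod>j\<in>{k<..<n}. s k - s j)"
    unfolding split using prod_uminus[of "\<lambda>j. s k - s j" "{..<k}"]
    by (subst prod.union_disjoint) auto
  also have "\<dots> > 0" using dec k by (intro mult_pos_pos prod_pos) auto
  finally show ?thesis .
qed

section \<open>Comparison of a bounded trigonometric form with the cosine\<close>

text \<open>The product equals 1 at \<open>t = 0\<close>, so it has a maximum there, and its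
  derivative at that point is the sum.\<close>

lemma sum_eq_0_if_prod_cos_sin_maximal_at_0:
  fixes c :: "'i \<Rightarrow> real"
  assumes fin: "finite I" and bound: "\<And>t. (\<Prod>i\<in>I. cos t + c i * sin t) \<le> 1"
  shows "(\<Sum>i\<in>I. c i) = 0"
proof -
  let ?T = "\<lambda>t. \<Prod>i\<in>I. cos t + c i * sin t"
  have "((\<lambda>t. cos t + c i * sin t) has_field_derivative c i) (at 0)" for i
    by (auto intro!: derivative_eq_intros)
  then have "(?T has_field_derivative
      (\<Sum>i\<in>I. c i * (\<Prod>j\<in>I-{i}. cos 0 + c j * sin 0))) (at 0)"
    by (intro has_field_derivative_prod) auto
  then have "(?T has_field_derivative (\<Sum>i\<in>I. c i)) (at 0)" by simp
  from DERIV_local_max[OF this zero_less_one] show ?thesis using bound by simp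
qed

text \<open>With \<open>n = card I\<close>, dividing by \<open>sin t ^ n\<close> turns the difference of the two sides into a
  polynomial in \<open>cot t\<close> of degree at most \<open>n - 2\<close>, so its divided difference at \<open>t\<close> and the
  \<open>k \<pi> / n\<close>, \<open>0 < k < n\<close>, vanishes. As \<open>cos (n t) = \<plusminus>1\<close> at the latter points, all terms there are
  nonnegative, and if the claim failed, the term at \<open>t\<close> would be positive.\<close>
lemma prod_cos_sin_ge_cos_multiple:
  fixes c :: "'i \<Rightarrow> real" and t :: real
  assumes fin: "finite I" and ne: "I \<noteq> {}"
    and bound: "\<And>t. \<bar>\<Prod>i\<in>I. cos t + c i * sin t\<bar> \<le> 1"
    and t: "0 < t" "t < pi / card I"
  shows "cos (card I * t) \<le> (\<Prod>i\<in>I. cos t + c i * sin t)"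
proof (rule ccontr)
  define n where "n = card I"
  define T where "T t = (\<Prod>i\<in>I. cos t + c i * sin t)" for t
  assume "\<not> ?thesis"
  then have neg: "T t < cos (n * t)" by (simp add: T_def n_def)
  have n: "n \<ge> 1" using fin ne by (simp add: n_def Suc_le_eq card_gt_0_iff)
  have c0: "(\<Sum>i\<in>I. c i) = 0"
    using bound by (intro sum_eq_0_if_prod_cos_sin_maximal_at_0 fin) (auto simp: abs_le_iff)
  obtain A :: "real poly" where
    A: "\<And>t. sin t \<noteq> 0 \<Longrightarrow> sin t ^ n * poly A (cot t) = cos (real n * t)"
    and cA: "coeff A n = 1" "coeff A (n - 1) = 0" "\<forall>k>n. coeff A k = 0"
    using ex_cot_multiple_angle_polys[OF n] by blast
  define r where "r = A - (\<Prod>i\<in>I. [:c i, 1:])"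
  \<comment> \<open>Both polynomials are monic of degree \<open>n\<close>, and by \<open>c0\<close>
    and \<open>cA\<close> both have coefficient 0 at \<open>n - 1\<close>, so two degrees are
    lost.\<close>
  have r0: "coeff r k = 0" if "n \<le> Suc k" for k
  proof -
    note cP = coeff_prod_monic_linear[OF fin, where c = c, folded n_def]
    have "k = n - 1 \<or> k = n \<or> k > n" using that by arith
    then show ?thesis
      unfolding r_def coeff_diff using cA cP(1) cP(2)[of k] cP(3)[OF ne] c0 by fastforce
  qed
  have rval: "sin x ^ n * poly r (cot x) = cos (n * x) - T x" if "sin x \<noteq> 0" for x :: real
  proof -
    have "sin x ^ n * (\<Prod>i\<in>I. c i + cot x) = (\<Prod>i\<in>I. sin x * (c i + cot x))"
      by (simp add: prod.distrib n_def)
    also have "\<dots> = T x" unfolding T_def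
      using that by (intro prod.cong) (auto simp: cot_def field_simps)
    finally show ?thesis using A[OF that] by (simp add: r_def poly_prod algebra_simps)
  qed
  \<comment> \<open>The free index 0 holds \<open>t\<close>: the point \<open>0 * pi / n\<close> is
    a zero of the sine, and \<open>t < pi / n\<close> keeps the sequence increasing.\<close>
  define \<theta> where "\<theta> k = (if k = 0 then t else k * pi / n)" for k :: nat
  have \<theta>_mono: "\<theta> i < \<theta> j" if "i < j" for i j
  proof (cases "i = 0")
    case True
    have "pi / n \<le> j * pi / n" using that n by (intro divide_right_mono) auto
    then show ?thesis using True that t by (simp add: \<theta>_def n_def)
  qed (use that n in \<open>auto simp: \<theta>_def divide_strict_right_mono\<close>)
  have \<theta>_range: "0 < \<theta> k" "\<theta> k < pi" if "k < n" for k
  proof -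
    show "0 < \<theta> k" using t n by (auto simp: \<theta>_def)
    have "\<theta> k < \<theta> n" using \<theta>_mono that by blast
    then show "\<theta> k < pi" using n by (simp add: \<theta>_def)
  qed
  define s where "s k = cot (\<theta> k)" for k
  have dec: "s j < s i" if "i < j" "j < n" for i j
    unfolding s_def using that \<theta>_range \<theta>_mono by (intro cot_strict_antimono) auto
  have inj: "inj_on s {..<n}"
    by (intro linorder_inj_onI) (use dec in force)+
  let ?w = "\<lambda>k. \<Prod>j\<in>{..<n}-{k}. s k - s j"
  have sinpos: "sin (\<theta> k) > 0" if "k < n" for k
    using \<theta>_range that by (intro sin_gt_zero)
  have nonneg: "poly r (s k) / ?w k \<ge> 0" if "k < n" "k \<noteq> 0" for k
  proof -
    have "cos (n * \<theta> k) = (-1) ^ k" using that n by (simp add: \<theta>_def cos_npi)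
    moreover have "\<bar>T (\<theta> k)\<bar> \<le> 1" using bound by (simp add: T_def)
    ultimately have "(-1) ^ k * (cos (n * \<theta> k) - T (\<theta> k)) \<ge> 0"
      by (cases "even k") auto
    then have "sin (\<theta> k) ^ n * ((-1) ^ k * poly r (s k)) \<ge> 0"
      using rval[where x = "\<theta> k"] sinpos[OF that(1)]
      by (simp add: s_def mult.left_commute)
    then have "(-1) ^ k * poly r (s k) \<ge> 0"
      using sinpos[OF that(1)] by (meson mult_pos_neg not_less zero_less_power)
    \<comment> \<open>Numerator and denominator carry the same alternating sign, which
      cancels.\<close>
    then have "((-1) ^ k * poly r (s k)) / ((-1) ^ k * ?w k) \<ge> 0"
      using sign_prod_differences_decreasing[OF dec that(1)] by (intro divide_nonneg_pos) auto
    then show ?thesis by simp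
  qed
  have pos: "poly r (s 0) / ?w 0 > 0"
  proof -
    have "sin (\<theta> 0) ^ n * poly r (s 0) > 0"
      using rval[where x = "\<theta> 0"] sinpos[where k = 0] n neg by (simp add: s_def \<theta>_def)
    then have "poly r (s 0) > 0"
      using sinpos[where k = 0] n by (simp add: zero_less_mult_iff)
    moreover have "?w 0 > 0"
      using sign_prod_differences_decreasing[OF dec, where k = 0 and n = n] n by simp
    ultimately show ?thesis by simp
  qed
  have "(\<Sum>k<n. poly r (s k) / ?w k) > 0"
  proof (rule sum_pos2[of _ 0])
    show "0 \<le> poly r (s k) / ?w k" if "k \<in> {..<n}" for k
      using that nonneg[of k] pos by (cases "k = 0") (auto simp only: lessThan_iff less_imp_le)
  qed (use pos n in auto)
  then show False using divided_difference_eq_0[OF _ inj, of r] r0 by simp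
qed

section \<open>Reduction of the geometric statement to a circle\<close>

text \<open>Finitely many hyperplanes through 0 form a null set and cannot cover the space. This
  makes the maximal product positive.\<close>

lemma ex_unit_vector_inner_nonzero:
  fixes v :: "'i \<Rightarrow> 'a::euclidean_space"
  assumes "finite I" and "\<And>i. i \<in> I \<Longrightarrow> v i \<noteq> 0"
  obtains x where "norm x = 1" "\<And>i. i \<in> I \<Longrightarrow> inner (v i) x \<noteq> 0"
proof -
  have "negligible (\<Union>i\<in>I. {x. inner (v i) x = 0})"
    using assms by (intro negligible_Union) (auto simp: negligible_hyperplane)
  then have "negligible (insert 0 (\<Union>i\<in>I. {x. inner (v i) x = 0}))" by simp
  then have "insert 0 (\<Union>i\<in>I. {x. inner (v i) x = 0}) \<noteq> UNIV"
    using non_negligible_UNIV by metis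
  then obtain y where "y \<noteq> 0" "\<And>i. i \<in> I \<Longrightarrow> inner (v i) y \<noteq> 0" by auto
  then show ?thesis by (intro that[of "y /\<^sub>R norm y"]) auto
qed

theorem mainTheorem1:
  fixes n :: nat
    and v :: "nat \<Rightarrow> real ^ 'd"
    and u :: "real ^ 'd"
  assumes "n \<ge> 1"
    and "\<And>i. i \<in> {1..n} \<Longrightarrow> norm (v i) = 1"
    and "norm u = 1"
    and "\<And>x :: real ^ 'd. norm x = 1 \<Longrightarrow>
           (\<Prod>i=1..n. \<bar>inner (v i) x\<bar>) \<le> (\<Prod>i=1..n. \<bar>inner (v i) u\<bar>)"
  shows "\<forall>i\<in>{1..n}. \<bar>inner (v i) u\<bar> \<ge> sin (pi / (2 * real n))"
proof (intro ballI, rule ccontr)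
  fix m assume m: "m \<in> {1..n}" and "\<not> \<bar>inner (v m) u\<bar> \<ge> sin (pi / (2 * real n))"
  define a where "a = inner (v m) u"
  have small: "\<bar>a\<bar> < sin (pi / (2 * real n))"
    using \<open>\<not> \<bar>inner (v m) u\<bar> \<ge> _\<close> by (simp add: a_def)
  have angle: "0 < pi / (2 * real n)" "pi / (2 * real n) \<le> pi / 2"
    using assms(1) by (auto simp: field_simps)
  obtain x where x: "norm x = 1" "\<And>i. i \<in> {1..n} \<Longrightarrow> inner (v i) x \<noteq> 0"
    using ex_unit_vector_inner_nonzero[of "{1..n}" v] assms(2)
    by (metis finite_atLeastAtMost norm_zero zero_neq_one)
  have "0 < (\<Prod>i=1..n. \<bar>inner (v i) x\<bar>)" using x by (intro prod_pos) auto
  also have "\<dots> \<le> (\<Prod>i=1..n. \<bar>inner (v i) u\<bar>)" using assms(4) x by blast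
  finally have M: "0 < (\<Prod>i=1..n. \<bar>inner (v i) u\<bar>)" .
  have nz: "inner (v i) u \<noteq> 0" if "i \<in> {1..n}" for i
  proof
    assume "inner (v i) u = 0"
    then have "(\<Prod>i=1..n. \<bar>inner (v i) u\<bar>) = 0" using that by (intro prod_zero) auto
    then show False using M by linarith
  qed
  \<comment> \<open>The angle between \<open>u\<close> and the hyperplane orthogonal to
    \<open>v m\<close>.\<close>
  define \<theta> where "\<theta> = arcsin \<bar>a\<bar>"
  \<comment> \<open>So \<open>v m\<close> is not parallel to \<open>u\<close>, and the normalisation
    of \<open>w\<close> below does not divide by 0.\<close>
  have "\<bar>a\<bar> < 1" using small sin_le_one order_less_le_trans by blast
  have \<theta>: "0 < \<theta>" "\<theta> < pi / (2 * real n)"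
  proof -
    show "0 < \<theta>" using nz[OF m] \<open>\<bar>a\<bar> < 1\<close> arcsin_less_mono[of 0 "\<bar>a\<bar>"]
      by (simp add: \<theta>_def a_def)
    have "\<theta> < arcsin (sin (pi / (2 * real n)))"
      unfolding \<theta>_def using small \<open>\<bar>a\<bar> < 1\<close> by (subst arcsin_less_mono) auto
    then show "\<theta> < pi / (2 * real n)" using angle by (simp add: arcsin_sin)
  qed
  have sin\<theta>: "sin \<theta> = \<bar>a\<bar>" using \<open>\<bar>a\<bar> < 1\<close> by (simp add: \<theta>_def)
  have cos\<theta>: "cos \<theta> = sqrt (1 - a\<^sup>2)" using \<open>\<bar>a\<bar> < 1\<close> by (simp add: \<theta>_def cos_arcsin)
  have b: "1 - a\<^sup>2 > 0" using \<open>\<bar>a\<bar> < 1\<close> by (simp add: abs_square_less_1)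
  \<comment> \<open>The component of \<open>v m\<close> orthogonal to \<open>u\<close>, normalised;
    the factor \<open>- sgn a\<close> puts the zero of the factor of \<open>v m\<close> at the
    positive angle \<open>\<theta>\<close>.\<close>
  define w where "w = (- sgn a / sqrt (1 - a\<^sup>2)) *\<^sub>R (v m - a *\<^sub>R u)"
  have uu: "inner u u = 1" and vv: "inner (v m) (v m) = 1"
    using assms(2)[OF m] assms(3) by (auto simp: norm_eq_1)
  have wu: "inner w u = 0" by (simp add: w_def inner_diff_left uu a_def)
  have vw: "inner (v m) w = - sgn a * sqrt (1 - a\<^sup>2)"
    using b by (simp add: w_def inner_diff_right vv a_def[symmetric] power2_eq_square field_simps
        real_sqrt_mult_self)
  have ww: "inner w w = 1"
  proof -
    have "inner (v m - a *\<^sub>R u) (v m - a *\<^sub>R u) = 1 - a\<^sup>2"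
      by (simp add: inner_diff inner_commute[of u "v m"] uu vv a_def[symmetric] power2_eq_square)
    then have "inner w w = (sgn a)\<^sup>2"
      unfolding w_def inner_scaleR_left inner_scaleR_right using b
      by (simp only:) (simp add: power2_eq_square[of "sgn a"])
    then show ?thesis using nz[OF m] by (simp add: a_def sgn_if)
  qed
  \<comment> \<open>Dividing each factor by its value at \<open>u\<close> makes the form equal to 1
    at \<open>t = 0\<close>; maximality of \<open>u\<close> then bounds its modulus by 1.\<close>
  define c where "c i = inner (v i) w / inner (v i) u" for i
  have factor: "inner (v i) (cos t *\<^sub>R u + sin t *\<^sub>R w) = inner (v i) u * (cos t + c i * sin t)"
    if "i \<in> {1..n}" for i t
    using nz[OF that] by (simp add: c_def inner_add_right field_simps)
  have bound: "\<bar>\<Prod>i=1..n. cos t + c i * sin t\<bar> \<le> 1" for t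
  proof -
    have "inner (cos t *\<^sub>R u + sin t *\<^sub>R w) (cos t *\<^sub>R u + sin t *\<^sub>R w) = (cos t)\<^sup>2 + (sin t)\<^sup>2"
      by (simp add: inner_add inner_commute[of u w] wu uu ww power2_eq_square)
    then have "norm (cos t *\<^sub>R u + sin t *\<^sub>R w) = 1" by (simp add: norm_eq_1)
    from assms(4)[OF this]
    have "(\<Prod>i=1..n. \<bar>inner (v i) u\<bar>) * \<bar>\<Prod>i=1..n. cos t + c i * sin t\<bar>
        \<le> (\<Prod>i=1..n. \<bar>inner (v i) u\<bar>)"
      by (simp add: factor abs_mult prod.distrib abs_prod)
    then show ?thesis using M by (simp add: mult_le_cancel_left2)
  qed
  have "cos (n * \<theta>) \<le> (\<Prod>i=1..n. cos \<theta> + c i * sin \<theta>)"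
  proof -
    have "pi / (2 * real n) \<le> pi / n" using assms(1) by (simp add: field_simps)
    then show ?thesis
      using prod_cos_sin_ge_cos_multiple[of "{1..n}" c \<theta>] bound \<theta> assms(1) by simp
  qed
  also have "(\<Prod>i=1..n. cos \<theta> + c i * sin \<theta>) = 0"
  proof -
    have "cos \<theta> + c m * sin \<theta> = 0"
      using nz[OF m] by (simp add: c_def vw sin\<theta> cos\<theta> a_def[symmetric] sgn_if)
    then show ?thesis using m by (auto simp: prod_zero_iff)
  qed
  finally have "cos (n * \<theta>) \<le> 0" .
  \<comment> \<open>On this range the cosine is positive, contrary to the comparison at the zero
    \<open>\<theta>\<close>.\<close>
  moreover have "0 < n * \<theta>" "n * \<theta> < pi / 2"
    using \<theta> assms(1) by (auto simp: field_simps)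
  ultimately show False using cos_gt_zero by fastforce
qed

end
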